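(* Let $KB=\langle P,Ab,IC,K\rangle$ be a Horn knowledge base with $IC=\emptyset$, and let $-$ be a contraction operator on $KB^{\bullet}$ satisfying all the AGM postulates $(-1)$ to $(-8)$. Define a contraction function $\dot{-}$ on $KB$ by: for every sentence $\alpha$, $KB\dot{-}\alpha$ is a Horn knowledge base with $(KB\dot{-}\alpha)^{\bullet}=KB^{\bullet}-\alpha$. Then $\dot{-}$ satisfies all the rationality postulates $(\dot{-}1)$ to $(\dot{-}8)$.
   Context: Fix a first-order language $\mathcal{L}$; "sentence" means a sentence of $\mathcal{L}$. A Horn knowledge base is a tuple $KB=\langle P,Ab,IC,K\rangle$ where: $P$ is an acyclic normal logic program (there is a level mapping from ground atoms to $\mathbb{N}$ such that in every ground clause $H\leftarrow L_1,\dots,L_n$ of $P$ the level of $H$ exceeds that of each $L_i$, with $|\neg A|=|A|$), all abducibles at level $0$ and no non-abducible at level $0$; $Ab$ is a set of atoms (abducibles); $IC$ is a set of sentences (integrity constraints); $K$ is a set of sentences whose atoms are all in $Ab$. An abductive interpretation is a set $I\subseteq Ab$. A level-$0$ atom $A$ is true in $I$ iff $A\in I$; an atom $A$ of level $n>0$ is true in $I$ iff some clause $A\leftarrow L_1,\dots,L_k$ of the ground instantiation of $P$ has all positive $L_j$ true in $I$ and, for every negative $L_j=\neg B_j$, $B_j$ false in $I$. Truth extends to sentences classically ($\forall$/$\exists$ via ground instances). $Mod(X)$ is the set of abductive interpretations making the sentence (or all sentences of the set) $X$ true; $Cn_P(X)=\{\alpha: Mod(X)\subseteq Mod(\alpha)\}$;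 $Mod(KB)=Mod(K\cup IC)$; $KB^\bullet=Cn_P(K\cup IC)$; $\alpha$ is accepted in $KB$ iff $\alpha\in KB^\bullet$. $KB_1\equiv KB_2$ iff $P_1=P_2,Ab_1=Ab_2,IC_1=IC_2$ and $Mod(K_1)=Mod(K_2)$. Contraction postulates for $KB\dot{-}\alpha=\langle P',Ab',IC',K'\rangle$: $(\dot{-}1)$ $P'=P,Ab'=Ab,IC'=IC$; $(\dot{-}2)$ if $\alpha$ is not true in all abductive interpretations, then $\alpha$ is not accepted in $KB\dot{-}\alpha$; $(\dot{-}3)$ $Mod(KB)\subseteq Mod(KB\dot{-}\alpha)$; $(\dot{-}4)$ if $\alpha$ is not accepted in $KB$ then $Mod(KB\dot{-}\alpha)=Mod(KB)$; $(\dot{-}5)$ $Mod(KB\dot{-}\alpha)\cap Mod(\alpha)\subseteq Mod(KB)$; $(\dot{-}6)$ if $KB\equiv KB'$ and $Mod(\alpha)=Mod(\beta)$ then $Mod(KB\dot{-}\alpha)=Mod(KB'\dot{-}\beta)$; $(\dot{-}7)$ $Mod(KB\dot{-}(\alpha\land\beta))\subseteq Mod(KB\dot{-}\alpha)\cup Mod(KB\dot{-}\beta)$; $(\dot{-}8)$ if $\alpha$ is not accepted in $KB\dot{-}(\alpha\land\beta)$ then $Mod(KB\dot{-}\alpha)\subseteq Mod(KB\dot{-}(\alpha\land\beta))$. AGM setting (with respect to $Cn_P$): a belief set is a set $T$ of sentences with $T=Cn_P(T)$; $T\#\alpha=Cn_P(T\cup\{\alpha\})$; $\vdash\varphi$ means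 $\varphi\in Cn_P(\emptyset)$. AGM contraction postulates for $T=KB^\bullet$: $(-1)$ $T-\alpha$ is a belief set; $(-2)$ $T-\alpha\subseteq T$; $(-3)$ if $\alpha\notin T$ then $T-\alpha=T$; $(-4)$ if $\nvdash\alpha$ then $\alpha\notin T-\alpha$; $(-5)$ if $\vdash\alpha\leftrightarrow\beta$ then $T-\alpha=T-\beta$; $(-6)$ $T\subseteq(T-\alpha)\#\alpha$; $(-7)$ $(T-\alpha)\cap(T-\beta)\subseteq T-(\alpha\land\beta)$; $(-8)$ if $\alpha\notin T-(\alpha\land\beta)$ then $T-(\alpha\land\beta)\subseteq T-\alpha$.
   Formalization: It is assumed that contraction changes only K, keeping P, Ab and IC (otherwise (∸1) can fail, e.g. by adding a tautology to IC), and that the contraction function is defined by the same recipe on every Horn knowledge base equivalent to KB, as (∸6) needs. *)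

theory Defs
  imports Main
begin

section \<open>Terms, atoms, clauses and formulas of a first-order language\<close>

record ('f, 'p) language =
  Funs :: "('f \<times> nat) set"
  Preds :: "('p \<times> nat) set"

datatype 'f trm = Var nat | Fun 'f "'f trm list"

datatype ('f, 'p) atm = Atm (pred: 'p) (args: "'f trm list")

datatype ('f, 'p) literal = Pos (atom_of: "('f, 'p) atm") | Neg (atom_of: "('f, 'p) atm")

datatype ('f, 'p) clause = Clause (head: "('f, 'p) atm") (body: "('f, 'p) literal list")

datatype ('f, 'p) fm =
    FAtom "('f, 'p) atm"
  | FNot "('f, 'p) fm"
  | FAnd "('f, 'p) fm" "('f, 'p) fm"
  | FOr "('f, 'p) fm" "('f, 'p) fm"
  | FImp "('f, 'p) fm" "('f, 'p) fm"
  | FIff "('f, 'p) fm" "('f, 'p) fm"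
  | FAll nat "('f, 'p) fm"
  | FEx nat "('f, 'p) fm"

fun vars_trm :: "'f trm \<Rightarrow> nat set" where
  "vars_trm (Var x) = {x}"
| "vars_trm (Fun f ts) = (\<Union>t\<in>set ts. vars_trm t)"

primrec subst_trm :: "(nat \<Rightarrow> 'f trm) \<Rightarrow> 'f trm \<Rightarrow> 'f trm" where
  "subst_trm \<sigma> (Var x) = \<sigma> x"
| "subst_trm \<sigma> (Fun f ts) = Fun f (map (subst_trm \<sigma>) ts)"

fun wf_trm :: "('f, 'p) language \<Rightarrow> 'f trm \<Rightarrow> bool" where
  "wf_trm L (Var x) \<longleftrightarrow> True"
| "wf_trm L (Fun f ts) \<longleftrightarrow> (f, length ts) \<in> Funs L \<and> (\<forall>t\<in>set ts. wf_trm L t)"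

definition ground_terms :: "('f, 'p) language \<Rightarrow> 'f trm set" where
  "ground_terms L = {t. wf_trm L t \<and> vars_trm t = {}}"

definition vars_atm :: "('f, 'p) atm \<Rightarrow> nat set" where
  "vars_atm A = (\<Union>t\<in>set (args A). vars_trm t)"

definition subst_atm :: "(nat \<Rightarrow> 'f trm) \<Rightarrow> ('f, 'p) atm \<Rightarrow> ('f, 'p) atm" where
  "subst_atm \<sigma> A = Atm (pred A) (map (subst_trm \<sigma>) (args A))"

definition wf_atm :: "('f, 'p) language \<Rightarrow> ('f, 'p) atm \<Rightarrow> bool" where
  "wf_atm L A \<longleftrightarrow> (pred A, length (args A)) \<in> Preds L \<and> (\<forall>t\<in>set (args A). wf_trm L t)"

definition ground_atoms :: "('f, 'p) language \<Rightarrow> ('f, 'p) atm set" where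
  "ground_atoms L = {A. wf_atm L A \<and> vars_atm A = {}}"

primrec subst_lit :: "(nat \<Rightarrow> 'f trm) \<Rightarrow> ('f, 'p) literal \<Rightarrow> ('f, 'p) literal" where
  "subst_lit \<sigma> (Pos A) = Pos (subst_atm \<sigma> A)"
| "subst_lit \<sigma> (Neg A) = Neg (subst_atm \<sigma> A)"

definition vars_clause :: "('f, 'p) clause \<Rightarrow> nat set" where
  "vars_clause c = vars_atm (head c) \<union> (\<Union>l\<in>set (body c). vars_atm (atom_of l))"

definition subst_clause :: "(nat \<Rightarrow> 'f trm) \<Rightarrow> ('f, 'p) clause \<Rightarrow> ('f, 'p) clause" where
  "subst_clause \<sigma> c = Clause (subst_atm \<sigma> (head c)) (map (subst_lit \<sigma>) (body c))"

definition wf_clause :: "('f, 'p) language \<Rightarrow> ('f, 'p) clause \<Rightarrow> bool" where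
  "wf_clause L c \<longleftrightarrow> wf_atm L (head c) \<and> (\<forall>l\<in>set (body c). wf_atm L (atom_of l))"

text \<open>In the two notions of ground instance below only the variables that occur have to be
  mapped to ground terms, so that variable-free clauses and atoms have themselves as an instance
  even if the language has no ground terms (e.g. a propositional language).\<close>

definition ground_program :: "('f, 'p) language \<Rightarrow> ('f, 'p) clause set \<Rightarrow> ('f, 'p) clause set" where
  "ground_program L P =
     {subst_clause \<sigma> c | \<sigma> c. c \<in> P \<and> (\<forall>x\<in>vars_clause c. \<sigma> x \<in> ground_terms L)}"

definition atm_instances :: "('f, 'p) language \<Rightarrow> ('f, 'p) atm \<Rightarrow> ('f, 'p) atm set" where
  "atm_instances L A = {subst_atm \<sigma> A | \<sigma>. \<forall>x\<in>vars_atm A. \<sigma> x \<in> ground_terms L}"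

primrec wf_fm :: "('f, 'p) language \<Rightarrow> ('f, 'p) fm \<Rightarrow> bool" where
  "wf_fm L (FAtom A) \<longleftrightarrow> wf_atm L A"
| "wf_fm L (FNot p) \<longleftrightarrow> wf_fm L p"
| "wf_fm L (FAnd p q) \<longleftrightarrow> wf_fm L p \<and> wf_fm L q"
| "wf_fm L (FOr p q) \<longleftrightarrow> wf_fm L p \<and> wf_fm L q"
| "wf_fm L (FImp p q) \<longleftrightarrow> wf_fm L p \<and> wf_fm L q"
| "wf_fm L (FIff p q) \<longleftrightarrow> wf_fm L p \<and> wf_fm L q"
| "wf_fm L (FAll x p) \<longleftrightarrow> wf_fm L p"
| "wf_fm L (FEx x p) \<longleftrightarrow> wf_fm L p"

primrec free_vars :: "('f, 'p) fm \<Rightarrow> nat set" where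
  "free_vars (FAtom A) = vars_atm A"
| "free_vars (FNot p) = free_vars p"
| "free_vars (FAnd p q) = free_vars p \<union> free_vars q"
| "free_vars (FOr p q) = free_vars p \<union> free_vars q"
| "free_vars (FImp p q) = free_vars p \<union> free_vars q"
| "free_vars (FIff p q) = free_vars p \<union> free_vars q"
| "free_vars (FAll x p) = free_vars p - {x}"
| "free_vars (FEx x p) = free_vars p - {x}"

primrec atoms_fm :: "('f, 'p) fm \<Rightarrow> ('f, 'p) atm set" where
  "atoms_fm (FAtom A) = {A}"
| "atoms_fm (FNot p) = atoms_fm p"
| "atoms_fm (FAnd p q) = atoms_fm p \<union> atoms_fm q"
| "atoms_fm (FOr p q) = atoms_fm p \<union> atoms_fm q"
| "atoms_fm (FImp p q) = atoms_fm p \<union> atoms_fm q"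
| "atoms_fm (FIff p q) = atoms_fm p \<union> atoms_fm q"
| "atoms_fm (FAll x p) = atoms_fm p"
| "atoms_fm (FEx x p) = atoms_fm p"

definition sentences :: "('f, 'p) language \<Rightarrow> ('f, 'p) fm set" where
  "sentences L = {\<phi>. wf_fm L \<phi> \<and> free_vars \<phi> = {}}"

text \<open>Replacement of the free occurrences of a variable; it is only used with ground terms,
  so capture cannot occur.\<close>

primrec inst :: "nat \<Rightarrow> 'f trm \<Rightarrow> ('f, 'p) fm \<Rightarrow> ('f, 'p) fm" where
  "inst x t (FAtom A) = FAtom (subst_atm (Var(x := t)) A)"
| "inst x t (FNot p) = FNot (inst x t p)"
| "inst x t (FAnd p q) = FAnd (inst x t p) (inst x t q)"
| "inst x t (FOr p q) = FOr (inst x t p) (inst x t q)"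
| "inst x t (FImp p q) = FImp (inst x t p) (inst x t q)"
| "inst x t (FIff p q) = FIff (inst x t p) (inst x t q)"
| "inst x t (FAll y p) = FAll y (if y = x then p else inst x t p)"
| "inst x t (FEx y p) = FEx y (if y = x then p else inst x t p)"

primrec fm_size :: "('f, 'p) fm \<Rightarrow> nat" where
  "fm_size (FAtom A) = 0"
| "fm_size (FNot p) = Suc (fm_size p)"
| "fm_size (FAnd p q) = Suc (fm_size p + fm_size q)"
| "fm_size (FOr p q) = Suc (fm_size p + fm_size q)"
| "fm_size (FImp p q) = Suc (fm_size p + fm_size q)"
| "fm_size (FIff p q) = Suc (fm_size p + fm_size q)"
| "fm_size (FAll x p) = Suc (fm_size p)"
| "fm_size (FEx x p) = Suc (fm_size p)"

lemma fm_size_inst [simp]: "fm_size (inst x t p) = fm_size p"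
  by (induction p) auto


section \<open>Acyclic programs and truth in an abductive interpretation\<close>

definition level_mapping ::
    "('f, 'p) language \<Rightarrow> ('f, 'p) clause set \<Rightarrow> ('f, 'p) atm set \<Rightarrow> (('f, 'p) atm \<Rightarrow> nat) \<Rightarrow> bool" where
  "level_mapping L P Ab lv \<longleftrightarrow>
     (\<forall>c\<in>ground_program L P. \<forall>l\<in>set (body c). lv (atom_of l) < lv (head c)) \<and>
     (\<forall>A\<in>Ab. lv A = 0) \<and>
     (\<forall>A\<in>ground_atoms L - Ab. lv A \<noteq> 0)"

definition level :: "('f, 'p) language \<Rightarrow> ('f, 'p) clause set \<Rightarrow> ('f, 'p) atm set \<Rightarrow> ('f, 'p) atm \<Rightarrow> nat" where
  "level L P Ab = (SOME lv. level_mapping L P Ab lv)"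

text \<open>Truth of ground atoms, by recursion on the level. By lemma \<open>atom_true_iff\<close> below, the
  recursion equations hold for every level mapping, not just for the chosen one.\<close>

definition atom_true ::
    "('f, 'p) language \<Rightarrow> ('f, 'p) clause set \<Rightarrow> ('f, 'p) atm set \<Rightarrow> ('f, 'p) atm set \<Rightarrow> ('f, 'p) atm \<Rightarrow> bool" where
  "atom_true L P Ab I = wfrec (measure (level L P Ab))
     (\<lambda>tr A. if level L P Ab A = 0 then A \<in> I
             else \<exists>c\<in>ground_program L P. head c = A \<and>
                    (\<forall>l\<in>set (body c). case l of Pos B \<Rightarrow> tr B | Neg B \<Rightarrow> \<not> tr B))"

function fm_true :: "'f trm set \<Rightarrow> (('f, 'p) atm \<Rightarrow> bool) \<Rightarrow> ('f, 'p) fm \<Rightarrow> bool" where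
  "fm_true U v (FAtom A) \<longleftrightarrow> v A"
| "fm_true U v (FNot p) \<longleftrightarrow> \<not> fm_true U v p"
| "fm_true U v (FAnd p q) \<longleftrightarrow> fm_true U v p \<and> fm_true U v q"
| "fm_true U v (FOr p q) \<longleftrightarrow> fm_true U v p \<or> fm_true U v q"
| "fm_true U v (FImp p q) \<longleftrightarrow> (fm_true U v p \<longrightarrow> fm_true U v q)"
| "fm_true U v (FIff p q) \<longleftrightarrow> (fm_true U v p \<longleftrightarrow> fm_true U v q)"
| "fm_true U v (FAll x p) \<longleftrightarrow> (\<forall>t\<in>U. fm_true U v (inst x t p))"
| "fm_true U v (FEx x p) \<longleftrightarrow> (\<exists>t\<in>U. fm_true U v (inst x t p))"
  by pat_completeness auto
termination
  by (relation "measure (\<lambda>(U, v, p). fm_size p)") auto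

definition true_in ::
    "('f, 'p) language \<Rightarrow> ('f, 'p) clause set \<Rightarrow> ('f, 'p) atm set \<Rightarrow> ('f, 'p) atm set \<Rightarrow> ('f, 'p) fm \<Rightarrow> bool" where
  "true_in L P Ab I \<phi> \<longleftrightarrow> fm_true (ground_terms L) (atom_true L P Ab I) \<phi>"

definition Mod ::
    "('f, 'p) language \<Rightarrow> ('f, 'p) clause set \<Rightarrow> ('f, 'p) atm set \<Rightarrow> ('f, 'p) fm set \<Rightarrow> ('f, 'p) atm set set" where
  "Mod L P Ab X = {I. I \<subseteq> Ab \<and> (\<forall>\<phi>\<in>X. true_in L P Ab I \<phi>)}"

definition Cn ::
    "('f, 'p) language \<Rightarrow> ('f, 'p) clause set \<Rightarrow> ('f, 'p) atm set \<Rightarrow> ('f, 'p) fm set \<Rightarrow> ('f, 'p) fm set" where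
  "Cn L P Ab X = {\<alpha>\<in>sentences L. Mod L P Ab X \<subseteq> Mod L P Ab {\<alpha>}}"


section \<open>Horn knowledge bases\<close>

record ('f, 'p) kb =
  Prog :: "('f, 'p) clause set"
  Abd :: "('f, 'p) atm set"
  IC :: "('f, 'p) fm set"
  Know :: "('f, 'p) fm set"

definition horn_kb :: "('f, 'p) language \<Rightarrow> ('f, 'p) kb \<Rightarrow> bool" where
  "horn_kb L KB \<longleftrightarrow>
     (\<forall>c\<in>Prog KB. wf_clause L c) \<and>
     Abd KB \<subseteq> ground_atoms L \<and>
     (\<exists>lv. level_mapping L (Prog KB) (Abd KB) lv) \<and>
     IC KB \<subseteq> sentences L \<and>
     Know KB \<subseteq> sentences L \<and>
     (\<forall>\<phi>\<in>Know KB. \<forall>A\<in>atoms_fm \<phi>. atm_instances L A \<subseteq> Abd KB)"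

definition ModKB :: "('f, 'p) language \<Rightarrow> ('f, 'p) kb \<Rightarrow> ('f, 'p) atm set set" where
  "ModKB L KB = Mod L (Prog KB) (Abd KB) (Know KB \<union> IC KB)"

definition ModF :: "('f, 'p) language \<Rightarrow> ('f, 'p) kb \<Rightarrow> ('f, 'p) fm \<Rightarrow> ('f, 'p) atm set set" where
  "ModF L KB \<alpha> = Mod L (Prog KB) (Abd KB) {\<alpha>}"

definition bullet :: "('f, 'p) language \<Rightarrow> ('f, 'p) kb \<Rightarrow> ('f, 'p) fm set" where
  "bullet L KB = Cn L (Prog KB) (Abd KB) (Know KB \<union> IC KB)"

definition accepted :: "('f, 'p) language \<Rightarrow> ('f, 'p) kb \<Rightarrow> ('f, 'p) fm \<Rightarrow> bool" where
  "accepted L KB \<alpha> \<longleftrightarrow> \<alpha> \<in> bullet L KB"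

definition kb_equiv :: "('f, 'p) language \<Rightarrow> ('f, 'p) kb \<Rightarrow> ('f, 'p) kb \<Rightarrow> bool" where
  "kb_equiv L KB1 KB2 \<longleftrightarrow>
     Prog KB1 = Prog KB2 \<and> Abd KB1 = Abd KB2 \<and> IC KB1 = IC KB2 \<and>
     Mod L (Prog KB1) (Abd KB1) (Know KB1) = Mod L (Prog KB2) (Abd KB2) (Know KB2)"

lemma atom_true_iff:
  assumes KB: "horn_kb L KB" and lv: "level_mapping L (Prog KB) (Abd KB) lv"
    and A: "A \<in> ground_atoms L"
  shows "atom_true L (Prog KB) (Abd KB) I A \<longleftrightarrow>
    (if lv A = 0 then A \<in> I
     else \<exists>c\<in>ground_program L (Prog KB). head c = A \<and>
            (\<forall>l\<in>set (body c). case l of Pos B \<Rightarrow> atom_true L (Prog KB) (Abd KB) I B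
                                       | Neg B \<Rightarrow> \<not> atom_true L (Prog KB) (Abd KB) I B))"
proof -
  let ?P = "Prog KB" and ?Ab = "Abd KB"
  let ?lv = "level L ?P ?Ab" and ?tr = "atom_true L ?P ?Ab I"
  have lv': "level_mapping L ?P ?Ab ?lv"
    unfolding level_def using lv by (rule someI [where P = "level_mapping L ?P ?Ab" and x = lv])
  have eq0: "lv A = 0 \<longleftrightarrow> ?lv A = 0"
    using lv lv' A unfolding level_mapping_def by blast
  have cut_eq: "(case l of Pos B \<Rightarrow> cut ?tr (measure ?lv) A B | Neg B \<Rightarrow> \<not> cut ?tr (measure ?lv) A B) \<longleftrightarrow>
      (case l of Pos B \<Rightarrow> ?tr B | Neg B \<Rightarrow> \<not> ?tr B)"
    if "c \<in> ground_program L ?P" "head c = A" "l \<in> set (body c)" for c l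
  proof -
    have "?lv (atom_of l) < ?lv A"
      using lv' that unfolding level_mapping_def by blast
    then show ?thesis
      by (cases l) (auto simp: cut_def)
  qed
  have "?tr A \<longleftrightarrow> (if ?lv A = 0 then A \<in> I
     else \<exists>c\<in>ground_program L ?P. head c = A \<and>
        (\<forall>l\<in>set (body c). case l of Pos B \<Rightarrow> cut ?tr (measure ?lv) A B
                                  | Neg B \<Rightarrow> \<not> cut ?tr (measure ?lv) A B))"
    by (subst (1) def_wfrec [OF atom_true_def [THEN eq_reflection] wf_measure]) (rule refl)
  also have "\<dots> \<longleftrightarrow> (if lv A = 0 then A \<in> I
     else \<exists>c\<in>ground_program L ?P. head c = A \<and>
        (\<forall>l\<in>set (body c). case l of Pos B \<Rightarrow> ?tr B | Neg B \<Rightarrow> \<not> ?tr B))"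
    using cut_eq by (simp add: eq0 cong: conj_cong)
  finally show ?thesis .
qed


section \<open>Postulates for contraction of a knowledge base\<close>

type_synonym ('f, 'p) kb_contraction = "('f, 'p) kb \<Rightarrow> ('f, 'p) fm \<Rightarrow> ('f, 'p) kb"

definition kb_contr1 :: "('f, 'p) language \<Rightarrow> ('f, 'p) kb \<Rightarrow> ('f, 'p) kb_contraction \<Rightarrow> bool" where
  "kb_contr1 L KB con \<longleftrightarrow> (\<forall>\<alpha>\<in>sentences L.
     Prog (con KB \<alpha>) = Prog KB \<and> Abd (con KB \<alpha>) = Abd KB \<and> IC (con KB \<alpha>) = IC KB)"

definition kb_contr2 :: "('f, 'p) language \<Rightarrow> ('f, 'p) kb \<Rightarrow> ('f, 'p) kb_contraction \<Rightarrow> bool" where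
  "kb_contr2 L KB con \<longleftrightarrow> (\<forall>\<alpha>\<in>sentences L.
     \<not> (\<forall>I\<subseteq>Abd KB. true_in L (Prog KB) (Abd KB) I \<alpha>) \<longrightarrow> \<not> accepted L (con KB \<alpha>) \<alpha>)"

definition kb_contr3 :: "('f, 'p) language \<Rightarrow> ('f, 'p) kb \<Rightarrow> ('f, 'p) kb_contraction \<Rightarrow> bool" where
  "kb_contr3 L KB con \<longleftrightarrow> (\<forall>\<alpha>\<in>sentences L. ModKB L KB \<subseteq> ModKB L (con KB \<alpha>))"

definition kb_contr4 :: "('f, 'p) language \<Rightarrow> ('f, 'p) kb \<Rightarrow> ('f, 'p) kb_contraction \<Rightarrow> bool" where
  "kb_contr4 L KB con \<longleftrightarrow> (\<forall>\<alpha>\<in>sentences L.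
     \<not> accepted L KB \<alpha> \<longrightarrow> ModKB L (con KB \<alpha>) = ModKB L KB)"

definition kb_contr5 :: "('f, 'p) language \<Rightarrow> ('f, 'p) kb \<Rightarrow> ('f, 'p) kb_contraction \<Rightarrow> bool" where
  "kb_contr5 L KB con \<longleftrightarrow> (\<forall>\<alpha>\<in>sentences L.
     ModKB L (con KB \<alpha>) \<inter> ModF L KB \<alpha> \<subseteq> ModKB L KB)"

definition kb_contr6 :: "('f, 'p) language \<Rightarrow> ('f, 'p) kb \<Rightarrow> ('f, 'p) kb_contraction \<Rightarrow> bool" where
  "kb_contr6 L KB con \<longleftrightarrow> (\<forall>KB'. \<forall>\<alpha>\<in>sentences L. \<forall>\<beta>\<in>sentences L.
     horn_kb L KB' \<and> kb_equiv L KB KB' \<and> ModF L KB \<alpha> = ModF L KB \<beta> \<longrightarrow>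
     ModKB L (con KB \<alpha>) = ModKB L (con KB' \<beta>))"

definition kb_contr7 :: "('f, 'p) language \<Rightarrow> ('f, 'p) kb \<Rightarrow> ('f, 'p) kb_contraction \<Rightarrow> bool" where
  "kb_contr7 L KB con \<longleftrightarrow> (\<forall>\<alpha>\<in>sentences L. \<forall>\<beta>\<in>sentences L.
     ModKB L (con KB (FAnd \<alpha> \<beta>)) \<subseteq> ModKB L (con KB \<alpha>) \<union> ModKB L (con KB \<beta>))"

definition kb_contr8 :: "('f, 'p) language \<Rightarrow> ('f, 'p) kb \<Rightarrow> ('f, 'p) kb_contraction \<Rightarrow> bool" where
  "kb_contr8 L KB con \<longleftrightarrow> (\<forall>\<alpha>\<in>sentences L. \<forall>\<beta>\<in>sentences L.
     \<not> accepted L (con KB (FAnd \<alpha> \<beta>)) \<alpha> \<longrightarrow>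
     ModKB L (con KB \<alpha>) \<subseteq> ModKB L (con KB (FAnd \<alpha> \<beta>)))"


section \<open>The AGM postulates for contraction of a belief set\<close>

definition belief_set ::
    "('f, 'p) language \<Rightarrow> ('f, 'p) clause set \<Rightarrow> ('f, 'p) atm set \<Rightarrow> ('f, 'p) fm set \<Rightarrow> bool" where
  "belief_set L P Ab T \<longleftrightarrow> T \<subseteq> sentences L \<and> T = Cn L P Ab T"

definition expand ::
    "('f, 'p) language \<Rightarrow> ('f, 'p) clause set \<Rightarrow> ('f, 'p) atm set \<Rightarrow> ('f, 'p) fm set \<Rightarrow> ('f, 'p) fm \<Rightarrow> ('f, 'p) fm set" where
  "expand L P Ab T \<alpha> = Cn L P Ab (T \<union> {\<alpha>})"

definition AGM_contraction ::
    "('f, 'p) language \<Rightarrow> ('f, 'p) clause set \<Rightarrow> ('f, 'p) atm set \<Rightarrow> ('f, 'p) fm set \<Rightarrow>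
     (('f, 'p) fm set \<Rightarrow> ('f, 'p) fm \<Rightarrow> ('f, 'p) fm set) \<Rightarrow> bool" where
  "AGM_contraction L P Ab T con \<longleftrightarrow>
     (\<forall>\<alpha>\<in>sentences L. belief_set L P Ab (con T \<alpha>)) \<and>
     (\<forall>\<alpha>\<in>sentences L. con T \<alpha> \<subseteq> T) \<and>
     (\<forall>\<alpha>\<in>sentences L. \<alpha> \<notin> T \<longrightarrow> con T \<alpha> = T) \<and>
     (\<forall>\<alpha>\<in>sentences L. \<alpha> \<notin> Cn L P Ab {} \<longrightarrow> \<alpha> \<notin> con T \<alpha>) \<and>
     (\<forall>\<alpha>\<in>sentences L. \<forall>\<beta>\<in>sentences L. FIff \<alpha> \<beta> \<in> Cn L P Ab {} \<longrightarrow> con T \<alpha> = con T \<beta>) \<and>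
     (\<forall>\<alpha>\<in>sentences L. T \<subseteq> expand L P Ab (con T \<alpha>) \<alpha>) \<and>
     (\<forall>\<alpha>\<in>sentences L. \<forall>\<beta>\<in>sentences L. con T \<alpha> \<inter> con T \<beta> \<subseteq> con T (FAnd \<alpha> \<beta>)) \<and>
     (\<forall>\<alpha>\<in>sentences L. \<forall>\<beta>\<in>sentences L.
        \<alpha> \<notin> con T (FAnd \<alpha> \<beta>) \<longrightarrow> con T (FAnd \<alpha> \<beta>) \<subseteq> con T \<alpha>)"

end

theory Submission
  imports Defs
begin

text \<open>A set of sentences and its closure under consequence have the same models, so every inclusion
  between closed theories reverses to an inclusion between the model sets of the knowledge bases
  that generate them. Each postulate then translates into its AGM counterpart; only the seventh needs
  an extra idea, namely that an interpretation refuting some member of each of two theories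
  refutes the disjunction of these members, which lies in both theories.\<close>

lemma FAnd_in_sentences_iff [simp]:
  "FAnd \<phi> \<psi> \<in> sentences L \<longleftrightarrow> \<phi> \<in> sentences L \<and> \<psi> \<in> sentences L"
  by (auto simp: sentences_def)

lemma FOr_in_sentences_iff [simp]:
  "FOr \<phi> \<psi> \<in> sentences L \<longleftrightarrow> \<phi> \<in> sentences L \<and> \<psi> \<in> sentences L"
  by (auto simp: sentences_def)

lemma FIff_in_sentences_iff [simp]:
  "FIff \<phi> \<psi> \<in> sentences L \<longleftrightarrow> \<phi> \<in> sentences L \<and> \<psi> \<in> sentences L"
  by (auto simp: sentences_def)

lemma true_in_FOr [simp]:
  "true_in L P Ab I (FOr \<phi> \<psi>) \<longleftrightarrow> true_in L P Ab I \<phi> \<or> true_in L P Ab I \<psi>"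
  by (simp add: true_in_def)

lemma true_in_FIff [simp]:
  "true_in L P Ab I (FIff \<phi> \<psi>) \<longleftrightarrow> (true_in L P Ab I \<phi> \<longleftrightarrow> true_in L P Ab I \<psi>)"
  by (simp add: true_in_def)

lemma Mod_antimono: "X \<subseteq> Y \<Longrightarrow> Mod L P Ab Y \<subseteq> Mod L P Ab X"
  by (auto simp: Mod_def)

lemma Mod_Un: "Mod L P Ab (X \<union> Y) = Mod L P Ab X \<inter> Mod L P Ab Y"
  by (auto simp: Mod_def)

lemma Mod_Cn:
  assumes "X \<subseteq> sentences L"
  shows "Mod L P Ab (Cn L P Ab X) = Mod L P Ab X"
  using assms by (auto simp: Mod_def Cn_def)

lemma FOr_in_Cn:
  assumes "FOr \<phi> \<psi> \<in> sentences L" and "\<phi> \<in> X \<or> \<psi> \<in> X"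
  shows "FOr \<phi> \<psi> \<in> Cn L P Ab X"
  using assms by (auto simp: Cn_def Mod_def)

lemma Mod_Int_belief_sets:
  assumes S: "belief_set L P Ab S" and T: "belief_set L P Ab T"
  shows "Mod L P Ab (S \<inter> T) = Mod L P Ab S \<union> Mod L P Ab T"
proof
  show "Mod L P Ab (S \<inter> T) \<subseteq> Mod L P Ab S \<union> Mod L P Ab T"
  proof (rule subsetI, rule ccontr)
    fix I
    assume I: "I \<in> Mod L P Ab (S \<inter> T)" and "I \<notin> Mod L P Ab S \<union> Mod L P Ab T"
    then obtain \<phi> \<psi> where \<phi>: "\<phi> \<in> S" "\<not> true_in L P Ab I \<phi>"
      and \<psi>: "\<psi> \<in> T" "\<not> true_in L P Ab I \<psi>"
      by (auto simp: Mod_def)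
    have "FOr \<phi> \<psi> \<in> sentences L"
      using \<phi>(1) \<psi>(1) S T unfolding belief_set_def FOr_in_sentences_iff by blast
    then have "FOr \<phi> \<psi> \<in> Cn L P Ab S \<inter> Cn L P Ab T"
      using \<phi>(1) \<psi>(1) by (simp add: FOr_in_Cn)
    then have "FOr \<phi> \<psi> \<in> S \<inter> T"
      using S T unfolding belief_set_def by blast
    then have "true_in L P Ab I (FOr \<phi> \<psi>)"
      using I unfolding Mod_def by blast
    then show False
      using \<phi>(2) \<psi>(2) by simp
  qed
next
  show "Mod L P Ab S \<union> Mod L P Ab T \<subseteq> Mod L P Ab (S \<inter> T)"
    by (intro Un_least Mod_antimono Int_lower1 Int_lower2)
qed

lemma in_Cn_empty_iff:
  "\<phi> \<in> Cn L P Ab {} \<longleftrightarrow> \<phi> \<in> sentences L \<and> (\<forall>I\<subseteq>Ab. true_in L P Ab I \<phi>)"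
  by (auto simp: Cn_def Mod_def)

lemma FIff_in_Cn_empty_iff:
  assumes "\<phi> \<in> sentences L" and "\<psi> \<in> sentences L"
  shows "FIff \<phi> \<psi> \<in> Cn L P Ab {} \<longleftrightarrow> Mod L P Ab {\<phi>} = Mod L P Ab {\<psi>}"
  using assms by (auto simp: in_Cn_empty_iff Mod_def)

lemma Mod_bullet:
  assumes "horn_kb L KB"
  shows "Mod L (Prog KB) (Abd KB) (bullet L KB) = ModKB L KB"
  using assms by (simp add: ModKB_def bullet_def horn_kb_def Mod_Cn)

lemma kb_equiv_refl: "kb_equiv L KB KB"
  by (simp add: kb_equiv_def)

lemma bullet_cong: "kb_equiv L KB KB' \<Longrightarrow> bullet L KB = bullet L KB'"
  by (auto simp: kb_equiv_def bullet_def Cn_def Mod_Un)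


locale AGM_operator =
  fixes L :: "('f, 'p) language"
    and P :: "('f, 'p) clause set"
    and Ab :: "('f, 'p) atm set"
    and T :: "('f, 'p) fm set"
    and agm :: "('f, 'p) fm set \<Rightarrow> ('f, 'p) fm \<Rightarrow> ('f, 'p) fm set"
  assumes AGM: "AGM_contraction L P Ab T agm"
begin

lemma closure: "\<alpha> \<in> sentences L \<Longrightarrow> belief_set L P Ab (agm T \<alpha>)"
  using AGM unfolding AGM_contraction_def by metis

lemma inclusion: "\<alpha> \<in> sentences L \<Longrightarrow> agm T \<alpha> \<subseteq> T"
  using AGM unfolding AGM_contraction_def by metis

lemma vacuity: "\<alpha> \<in> sentences L \<Longrightarrow> \<alpha> \<notin> T \<Longrightarrow> agm T \<alpha> = T"
  using AGM unfolding AGM_contraction_def by metis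

lemma success: "\<alpha> \<in> sentences L \<Longrightarrow> \<alpha> \<notin> Cn L P Ab {} \<Longrightarrow> \<alpha> \<notin> agm T \<alpha>"
  using AGM unfolding AGM_contraction_def by metis

lemma extensionality:
  assumes "\<alpha> \<in> sentences L" and "\<beta> \<in> sentences L" and "Mod L P Ab {\<alpha>} = Mod L P Ab {\<beta>}"
  shows "agm T \<alpha> = agm T \<beta>"
  using AGM assms FIff_in_Cn_empty_iff[OF assms(1,2)] unfolding AGM_contraction_def by metis

lemma recovery: "\<alpha> \<in> sentences L \<Longrightarrow> T \<subseteq> Cn L P Ab (agm T \<alpha> \<union> {\<alpha>})"
  using AGM unfolding AGM_contraction_def expand_def by metis

lemma conjunctive_overlap:
  "\<alpha> \<in> sentences L \<Longrightarrow> \<beta> \<in> sentences L \<Longrightarrow> agm T \<alpha> \<inter> agm T \<beta> \<subseteq> agm T (FAnd \<alpha> \<beta>)"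
  using AGM unfolding AGM_contraction_def by metis

lemma conjunctive_inclusion:
  "\<alpha> \<in> sentences L \<Longrightarrow> \<beta> \<in> sentences L \<Longrightarrow> \<alpha> \<notin> agm T (FAnd \<alpha> \<beta>) \<Longrightarrow>
    agm T (FAnd \<alpha> \<beta>) \<subseteq> agm T \<alpha>"
  using AGM unfolding AGM_contraction_def by metis

lemma Mod_recovery:
  assumes \<alpha>: "\<alpha> \<in> sentences L"
  shows "Mod L P Ab (agm T \<alpha>) \<inter> Mod L P Ab {\<alpha>} \<subseteq> Mod L P Ab T"
proof -
  have "agm T \<alpha> \<union> {\<alpha>} \<subseteq> sentences L"
    using closure[OF \<alpha>] \<alpha> unfolding belief_set_def by blast
  then have "Mod L P Ab (agm T \<alpha>) \<inter> Mod L P Ab {\<alpha>} = Mod L P Ab (Cn L P Ab (agm T \<alpha> \<union> {\<alpha>}))"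
    by (simp only: Mod_Cn Mod_Un)
  also have "\<dots> \<subseteq> Mod L P Ab T"
    using recovery[OF \<alpha>] by (rule Mod_antimono)
  finally show ?thesis .
qed

lemma Mod_conjunctive_overlap:
  assumes \<alpha>: "\<alpha> \<in> sentences L" and \<beta>: "\<beta> \<in> sentences L"
  shows "Mod L P Ab (agm T (FAnd \<alpha> \<beta>)) \<subseteq> Mod L P Ab (agm T \<alpha>) \<union> Mod L P Ab (agm T \<beta>)"
proof -
  have "Mod L P Ab (agm T (FAnd \<alpha> \<beta>)) \<subseteq> Mod L P Ab (agm T \<alpha> \<inter> agm T \<beta>)"
    using conjunctive_overlap[OF \<alpha> \<beta>] by (rule Mod_antimono)
  also have "\<dots> = Mod L P Ab (agm T \<alpha>) \<union> Mod L P Ab (agm T \<beta>)"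
    using closure[OF \<alpha>] closure[OF \<beta>] by (rule Mod_Int_belief_sets)
  finally show ?thesis .
qed

end


locale AGM_kb_contraction =
  AGM_operator L "Prog KB" "Abd KB" "bullet L KB" agm
  for L :: "('f, 'p) language"
    and KB :: "('f, 'p) kb"
    and agm :: "('f, 'p) fm set \<Rightarrow> ('f, 'p) fm \<Rightarrow> ('f, 'p) fm set" +
  fixes con :: "('f, 'p) kb_contraction"
  assumes horn_kb: "horn_kb L KB"
    and realizes: "\<And>X \<alpha>. horn_kb L X \<Longrightarrow> kb_equiv L KB X \<Longrightarrow> \<alpha> \<in> sentences L \<Longrightarrow>
      (\<exists>K'. con X \<alpha> = X\<lparr>Know := K'\<rparr>) \<and>
      horn_kb L (con X \<alpha>) \<and>
      bullet L (con X \<alpha>) = agm (bullet L X) \<alpha>"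
begin

lemma con_signature:
  assumes "horn_kb L X" and "kb_equiv L KB X" and "\<alpha> \<in> sentences L"
  shows "Prog (con X \<alpha>) = Prog KB" and "Abd (con X \<alpha>) = Abd KB" and "IC (con X \<alpha>) = IC KB"
  using realizes[OF assms] assms(2) by (auto simp: kb_equiv_def)

lemma ModKB_con_equiv:
  assumes "horn_kb L X" and "kb_equiv L KB X" and "\<alpha> \<in> sentences L"
  shows "ModKB L (con X \<alpha>) = Mod L (Prog KB) (Abd KB) (agm (bullet L KB) \<alpha>)"
  using realizes[OF assms] Mod_bullet[of L "con X \<alpha>"]
  by (simp add: con_signature[OF assms] bullet_cong[OF assms(2)])

lemmas ModKB_con = ModKB_con_equiv[OF horn_kb kb_equiv_refl]

lemma accepted_con_iff:
  "\<alpha> \<in> sentences L \<Longrightarrow> accepted L (con KB \<alpha>) \<phi> \<longleftrightarrow> \<phi> \<in> agm (bullet L KB) \<alpha>"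
  using realizes[OF horn_kb kb_equiv_refl] by (simp add: accepted_def)

lemma kb_contr1: "kb_contr1 L KB con"
  using con_signature[OF horn_kb kb_equiv_refl] by (simp add: kb_contr1_def)

lemma kb_contr2: "kb_contr2 L KB con"
  using success by (simp add: kb_contr2_def accepted_con_iff in_Cn_empty_iff)

lemma kb_contr3: "kb_contr3 L KB con"
  using Mod_antimono[OF inclusion]
  by (simp add: kb_contr3_def ModKB_con flip: Mod_bullet[OF horn_kb])

lemma kb_contr4: "kb_contr4 L KB con"
  by (simp add: kb_contr4_def accepted_def vacuity ModKB_con Mod_bullet[OF horn_kb])

lemma kb_contr5: "kb_contr5 L KB con"
  using Mod_recovery
  by (simp add: kb_contr5_def ModF_def ModKB_con flip: Mod_bullet[OF horn_kb])

lemma kb_contr6: "kb_contr6 L KB con"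
  unfolding kb_contr6_def
proof (intro allI ballI impI, elim conjE)
  fix X \<alpha> \<beta>
  assume \<alpha>: "\<alpha> \<in> sentences L" and \<beta>: "\<beta> \<in> sentences L"
    and X: "horn_kb L X" "kb_equiv L KB X" and "ModF L KB \<alpha> = ModF L KB \<beta>"
  then have "agm (bullet L KB) \<alpha> = agm (bullet L KB) \<beta>"
    by (intro extensionality) (simp_all add: ModF_def)
  then show "ModKB L (con KB \<alpha>) = ModKB L (con X \<beta>)"
    by (simp only: ModKB_con[OF \<alpha>] ModKB_con_equiv[OF X \<beta>])
qed

lemma kb_contr7: "kb_contr7 L KB con"
  using Mod_conjunctive_overlap by (simp add: kb_contr7_def ModKB_con)

lemma kb_contr8: "kb_contr8 L KB con"
  by (simp add: kb_contr8_def accepted_con_iff ModKB_con Mod_antimono conjunctive_inclusion)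

end

theorem theorem9:
  fixes L :: "('f, 'p) language"
    and KB :: "('f, 'p) kb"
    and agm :: "('f, 'p) fm set \<Rightarrow> ('f, 'p) fm \<Rightarrow> ('f, 'p) fm set"
    and con :: "('f, 'p) kb \<Rightarrow> ('f, 'p) fm \<Rightarrow> ('f, 'p) kb"
  assumes "horn_kb L KB"
    and "IC KB = {}"
    and "AGM_contraction L (Prog KB) (Abd KB) (bullet L KB) agm"
    and "\<And>X \<alpha>. horn_kb L X \<Longrightarrow> kb_equiv L KB X \<Longrightarrow> \<alpha> \<in> sentences L \<Longrightarrow>
           (\<exists>K'. con X \<alpha> = X\<lparr>Know := K'\<rparr>) \<and>
           horn_kb L (con X \<alpha>) \<and>
           bullet L (con X \<alpha>) = agm (bullet L X) \<alpha>"
  shows "kb_contr1 L KB con \<and> kb_contr2 L KB con \<and> kb_contr3 L KB con \<and> kb_contr4 L KB con \<and>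
         kb_contr5 L KB con \<and> kb_contr6 L KB con \<and> kb_contr7 L KB con \<and> kb_contr8 L KB con"
proof -
  interpret AGM_kb_contraction L KB agm con
    using assms(1,3,4)
    by (intro AGM_kb_contraction.intro AGM_operator.intro AGM_kb_contraction_axioms.intro)
  show ?thesis
    by (intro conjI kb_contr1 kb_contr2 kb_contr3 kb_contr4 kb_contr5 kb_contr6 kb_contr7 kb_contr8)
qed

end
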